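(* Let $\mathcal V$ be a finite-dimensional real inner product space with induced norm $\|\cdot\|_2$, let $a\in\mathcal V$, $a\ne0$, $b\in\mathbb R$, and let $C=\{x\in\mathcal V\mid \langle a,x\rangle=b\}$ be a hyperplane. Let $\gamma\in\mathbb R$, $h\in\mathcal V$, $Q_0>0$, $Q(z):=\frac12\|z\|_2^2+Q_0$, $E_{\gamma,h}(x):=-\frac{\gamma+\langle h,x\rangle}{Q(x)}$, and assume $\sup_{x\in C}E_{\gamma,h}(x)>0$. Then the problem $\sup_{x\in C}E_{\gamma,h}(x)$ is solved by $u=P_C(-e^{-1}h)$, where $$P_C(y)=y-\left(\frac{\langle a,y\rangle-b}{\|a\|_2^2}\right)a$$ and the optimal value $e=E_{\gamma,h}(u)$ is $$e=\frac{-\beta_2+\sqrt{\beta_2^2-4\beta_1\beta_3}}{2\beta_1},$$ with $$\beta_1:=\frac{b^2}{2\|a\|_2^2}+Q_0,\qquad \beta_2:=\frac{b\langle a,h\rangle}{\|a\|_2^2}+\gamma,\qquad \beta_3:=\frac12\frac{\langle a,h\rangle^2}{\|a\|_2^2}-\frac12\|h\|_2^2 .$$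
   Context: $P_C(y):=\operatorname{argmin}_{x\in C}\frac12\|x-y\|_2^2$ denotes the orthogonal projection onto $C$. "The problem is solved by $u$" means that $u\in C$ is a maximizer of $E_{\gamma,h}$ over $C$. *)

theory Defs
  imports "HOL-Analysis.Analysis"
begin

definition hyperplane :: "'a::real_inner \<Rightarrow> real \<Rightarrow> 'a set" where
  "hyperplane a b = {x. inner a x = b}"

(* arg_min_on is a Hilbert choice among all minimizers; for a nonempty closed convex C
   there is exactly one, so the choice is immaterial. *)
definition proj :: "'a::real_inner set \<Rightarrow> 'a \<Rightarrow> 'a" where
  "proj C y = arg_min_on (\<lambda>x. 1/2 * (norm (x - y))\<^sup>2) C"

definition Q :: "real \<Rightarrow> 'a::real_inner \<Rightarrow> real" where
  "Q Q0 z = 1/2 * (norm z)\<^sup>2 + Q0"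

definition E :: "real \<Rightarrow> real \<Rightarrow> 'a::real_inner \<Rightarrow> 'a \<Rightarrow> real" where
  "E Q0 \<gamma> h x = - ((\<gamma> + inner h x) / Q Q0 x)"

(* The energy is bounded, so its real-valued supremum over any nonempty set is the genuine one. *)
lemma bdd_above_E:
  assumes "Q0 > 0"
  shows "bdd_above (E Q0 \<gamma> h ` C)"
proof (rule bdd_aboveI2)
  fix x assume "x \<in> C"
  define q where "q = Q Q0 x"
  have q: "q \<ge> Q0" "q > 0" "(norm x)\<^sup>2 \<le> 2 * q"
    using assms zero_le_power2[of "norm x"] by (simp_all add: q_def Q_def add_nonneg_pos)
  have "2 * (norm h * norm x) \<le> (norm h)\<^sup>2 + (norm x)\<^sup>2"
    using sum_squares_bound[of "norm h" "norm x"] by (simp add: mult.assoc)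
  moreover have "- inner h x \<le> norm h * norm x"
    using norm_cauchy_schwarz[of "- h" x] by simp
  ultimately have "- (\<gamma> + inner h x) \<le> \<bar>\<gamma>\<bar> + (norm h)\<^sup>2 + q"
    using q(3) zero_le_power2[of "norm h"] by linarith
  also have "\<dots> \<le> ((\<bar>\<gamma>\<bar> + (norm h)\<^sup>2) / Q0 + 1) * q"
  proof -
    have "(\<bar>\<gamma>\<bar> + (norm h)\<^sup>2) * 1 \<le> (\<bar>\<gamma>\<bar> + (norm h)\<^sup>2) * (q / Q0)"
      using q assms by (intro mult_left_mono) auto
    then show ?thesis by (simp add: algebra_simps add_divide_distrib)
  qed
  finally show "E Q0 \<gamma> h x \<le> (\<bar>\<gamma>\<bar> + (norm h)\<^sup>2) / Q0 + 1"
    using q(2) unfolding E_def q_def[symmetric] minus_divide_left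
    by (simp only: pos_divide_le_eq)
qed

end

theory Submission
  imports Defs
begin

text \<open>
  The proof is Dinkelbach's parametric method for fractional programming. As \<open>Q Q0\<close> is positive,
  \<open>E Q0 \<gamma> h x \<le> t\<close> is equivalent to \<open>\<gamma> + inner h x + t * Q Q0 x \<ge> 0\<close>, so bounding the quotient
  amounts to bounding a quadratic function of \<open>x\<close>. For \<open>t > 0\<close>, completing the square turns this
  quadratic into \<open>t / 2\<close> times the squared distance from \<open>x\<close> to \<open>- h / t\<close>, plus a constant.
  By Pythagoras its minimum over the hyperplane is attained at the projection of \<open>- h / t\<close>, and the
  minimum value is \<open>p t / t\<close> for the quadratic polynomial \<open>p t = \<beta>1 * t\<^sup>2 + \<beta>2 * t + \<beta>3\<close>
  (lemma \<open>parametric_energy_on_hyperplane\<close>).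

  Hence a number \<open>t > 0\<close> is an upper bound of the energy on the hyperplane exactly when \<open>p t \<ge> 0\<close>.
  The least upper bound \<open>e\<close>, if positive, therefore satisfies \<open>p e = 0\<close>: were \<open>p e > 0\<close>, then by
  continuity slightly smaller numbers would still be upper bounds. Two consequences follow.
  At the projection \<open>u\<close> of \<open>- h / e\<close> the parametric function vanishes, which says that the energy of
  \<open>u\<close> equals \<open>e\<close>. Moreover \<open>\<beta>1 > 0\<close> and \<open>\<beta>3 \<le> 0\<close> (the latter is Cauchy-Schwarz), so \<open>e\<close>, being
  positive, has to be the larger of the two roots of \<open>p\<close>.
\<close>

definition hyperplane_foot :: "'a::real_inner \<Rightarrow> real \<Rightarrow> 'a \<Rightarrow> 'a" where
  "hyperplane_foot a b y = y - ((inner a y - b) / (norm a)\<^sup>2) *\<^sub>R a"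

lemma hyperplane_foot_in_hyperplane:
  assumes "a \<noteq> 0"
  shows "hyperplane_foot a b y \<in> hyperplane a b"
  using assms
  by (simp add: hyperplane_foot_def hyperplane_def inner_diff_right power2_norm_eq_inner)

text \<open>
  Pythagoras: the vector from \<open>y\<close> to its foot is parallel to \<open>a\<close>, hence orthogonal to the
  hyperplane.
\<close>
lemma hyperplane_pythagoras:
  assumes "a \<noteq> 0" and x: "x \<in> hyperplane a b"
  shows "(norm (x - y))\<^sup>2
    = (norm (x - hyperplane_foot a b y))\<^sup>2 + (inner a y - b)\<^sup>2 / (norm a)\<^sup>2"
proof -
  define p where "p = hyperplane_foot a b y"
  define c where "c = (inner a y - b) / (norm a)\<^sup>2"
  have p: "p - y = (- c) *\<^sub>R a"
    by (simp add: p_def c_def hyperplane_foot_def)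
  have "inner a (x - p) = 0"
    using x hyperplane_foot_in_hyperplane[OF \<open>a \<noteq> 0\<close>, of b y]
    by (simp add: p_def hyperplane_def inner_diff_right)
  then have "orthogonal (x - p) (p - y)"
    unfolding p by (simp add: orthogonal_def inner_commute)
  then have "(norm ((x - p) + (p - y)))\<^sup>2 = (norm (x - p))\<^sup>2 + (norm (p - y))\<^sup>2"
    by (rule norm_add_Pythagorean)
  moreover have "(norm (p - y))\<^sup>2 = (inner a y - b)\<^sup>2 / (norm a)\<^sup>2"
    using \<open>a \<noteq> 0\<close> unfolding p
    by (simp add: c_def power_mult_distrib power_divide power2_eq_square)
  ultimately show ?thesis by (simp add: p_def)
qed

lemma proj_hyperplane:
  assumes "a \<noteq> 0"
  shows "proj (hyperplane a b) y = hyperplane_foot a b y"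
proof -
  let ?p = "hyperplane_foot a b y"
  have p: "?p \<in> hyperplane a b"
    by (rule hyperplane_foot_in_hyperplane[OF assms])
  have dist: "(norm (x - y))\<^sup>2 = (norm (x - ?p))\<^sup>2 + (norm (?p - y))\<^sup>2"
    if "x \<in> hyperplane a b" for x
    using hyperplane_pythagoras[OF assms that, of y] hyperplane_pythagoras[OF assms p, of y]
    by simp
  show ?thesis
    unfolding proj_def arg_min_on_def
  proof (rule arg_minI)
    show "?p \<in> hyperplane a b" by (fact p)
  next
    fix x assume "x \<in> hyperplane a b"
    then show "\<not> 1/2 * (norm (x - y))\<^sup>2 < 1/2 * (norm (?p - y))\<^sup>2"
      by (simp add: dist)
  next
    fix x assume x: "x \<in> hyperplane a b"
      and min: "\<forall>z. z \<in> hyperplane a b \<longrightarrow> \<not> 1/2 * (norm (z - y))\<^sup>2 < 1/2 * (norm (x - y))\<^sup>2"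
    have "(norm (x - y))\<^sup>2 \<le> (norm (?p - y))\<^sup>2"
      using min[rule_format, OF p] by linarith
    then have "(norm (x - ?p))\<^sup>2 \<le> 0"
      using dist[OF x] by simp
    then show "x = ?p" by simp
  qed
qed

lemma Q_pos:
  assumes "Q0 > 0"
  shows "Q Q0 x > 0"
  using assms by (simp add: Q_def add_nonneg_pos)

lemma energy_le_iff:
  assumes "Q0 > 0"
  shows "E Q0 \<gamma> h x \<le> t \<longleftrightarrow> 0 \<le> \<gamma> + inner h x + t * Q Q0 x"
  using Q_pos[OF assms, of x]
  by (simp add: E_def minus_divide_left pos_divide_le_eq) linarith

text \<open>
  The polynomial \<open>p\<close> of the introduction, with coefficients \<open>\<beta>1\<close>, \<open>\<beta>2\<close> and \<open>\<beta>3\<close>; for positive \<open>t\<close>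
  it is \<open>t\<close> times the minimum over the hyperplane of \<open>\<gamma> + inner h x + t * Q Q0 x\<close>.
\<close>
definition dinkelbach_poly :: "'a::real_inner \<Rightarrow> 'a \<Rightarrow> real \<Rightarrow> real \<Rightarrow> real \<Rightarrow> real \<Rightarrow> real" where
  "dinkelbach_poly a h b \<gamma> Q0 t
    = (b\<^sup>2 / (2 * (norm a)\<^sup>2) + Q0) * t\<^sup>2 + (b * inner a h / (norm a)\<^sup>2 + \<gamma>) * t
      + (1/2 * ((inner a h)\<^sup>2 / (norm a)\<^sup>2) - 1/2 * (norm h)\<^sup>2)"

text \<open>
  Completing the square around \<open>- h / t\<close> leaves a constant that still involves the distance from
  that point to the hyperplane; collecting powers of \<open>t\<close> produces the polynomial.
\<close>
lemma parametric_energy_on_hyperplane: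
  assumes a: "a \<noteq> 0" and t: "t > 0" and x: "x \<in> hyperplane a b"
  shows "\<gamma> + inner h x + t * Q Q0 x
    = t / 2 * (norm (x - hyperplane_foot a b (- (inverse t *\<^sub>R h))))\<^sup>2
      + dinkelbach_poly a h b \<gamma> Q0 t / t"
proof -
  define y where "y = - (inverse t *\<^sub>R h)"
  define n where "n = (norm a)\<^sup>2"
  have n: "n > 0" using a by (simp add: n_def)
  have square: "inner h x + t / 2 * (norm x)\<^sup>2
      = t / 2 * (norm (x - y))\<^sup>2 - (norm h)\<^sup>2 / (2 * t)"
    using t
    by (simp add: y_def power2_norm_eq_inner inner_add inner_commute field_simps)
  have inner_y: "inner a y = - (inner a h / t)"
    by (simp add: y_def divide_inverse)
  have gap: "t / 2 * ((inner a y - b)\<^sup>2 / n) - (norm h)\<^sup>2 / (2 * t) + \<gamma> + t * Q0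
      = dinkelbach_poly a h b \<gamma> Q0 t / t"
    using t n unfolding dinkelbach_poly_def n_def[symmetric] inner_y
    by (simp add: field_simps power2_eq_square)
  have "\<gamma> + inner h x + t * Q Q0 x
      = (inner h x + t / 2 * (norm x)\<^sup>2) + \<gamma> + t * Q0"
    by (simp add: Q_def algebra_simps)
  also have "\<dots> = t / 2 * (norm (x - hyperplane_foot a b y))\<^sup>2
      + (t / 2 * ((inner a y - b)\<^sup>2 / n) - (norm h)\<^sup>2 / (2 * t) + \<gamma> + t * Q0)"
    unfolding square hyperplane_pythagoras[OF a x, of y] n_def by (simp add: algebra_simps)
  finally show ?thesis unfolding gap unfolding y_def .
qed

lemma energy_bounded_on_hyperplane_iff:
  assumes a: "a \<noteq> 0" and Q0: "Q0 > 0" and t: "t > 0"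
  shows "(\<forall>x\<in>hyperplane a b. E Q0 \<gamma> h x \<le> t) \<longleftrightarrow> 0 \<le> dinkelbach_poly a h b \<gamma> Q0 t"
proof
  define p where "p = hyperplane_foot a b (- (inverse t *\<^sub>R h))"
  have p: "p \<in> hyperplane a b"
    unfolding p_def by (rule hyperplane_foot_in_hyperplane[OF a])
  assume "\<forall>x\<in>hyperplane a b. E Q0 \<gamma> h x \<le> t"
  then have "0 \<le> \<gamma> + inner h p + t * Q Q0 p"
    using p energy_le_iff[OF Q0] by blast
  then have "0 \<le> dinkelbach_poly a h b \<gamma> Q0 t / t"
    using parametric_energy_on_hyperplane[OF a t p, of \<gamma> h Q0] by (simp add: p_def)
  then show "0 \<le> dinkelbach_poly a h b \<gamma> Q0 t"
    using t by (simp add: zero_le_divide_iff)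
next
  assume "0 \<le> dinkelbach_poly a h b \<gamma> Q0 t"
  then show "\<forall>x\<in>hyperplane a b. E Q0 \<gamma> h x \<le> t"
    using t by (simp add: energy_le_iff[OF Q0] parametric_energy_on_hyperplane[OF a t])
qed

text \<open>
  At a positive supremum the polynomial is nonnegative because the supremum is an upper bound, and
  it is not positive because, by continuity, some smaller positive number would then be an upper
  bound as well.
\<close>
lemma dinkelbach_poly_SUP_energy:
  fixes a h :: "'a::real_inner"
  assumes a: "a \<noteq> 0" and Q0: "Q0 > 0"
    and e: "e = (SUP x\<in>hyperplane a b. E Q0 \<gamma> h x)" and pos: "e > 0"
  shows "dinkelbach_poly a h b \<gamma> Q0 e = 0"
proof (rule antisym)
  have "\<forall>x\<in>hyperplane a b. E Q0 \<gamma> h x \<le> e"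
    unfolding e by (intro ballI cSUP_upper bdd_above_E[OF Q0])
  then show "0 \<le> dinkelbach_poly a h b \<gamma> Q0 e"
    by (simp add: energy_bounded_on_hyperplane_iff[OF a Q0 pos])
  show "dinkelbach_poly a h b \<gamma> Q0 e \<le> 0"
  proof (rule ccontr)
    assume "\<not> dinkelbach_poly a h b \<gamma> Q0 e \<le> 0"
    moreover have "(dinkelbach_poly a h b \<gamma> Q0 \<longlongrightarrow> dinkelbach_poly a h b \<gamma> Q0 e) (at_left e)"
      unfolding dinkelbach_poly_def by (intro tendsto_intros)
    ultimately have "\<forall>\<^sub>F t in at_left e. 0 < dinkelbach_poly a h b \<gamma> Q0 t"
      by (intro order_tendstoD) auto
    moreover have "\<forall>\<^sub>F t in at_left e. t \<in> {0<..<e}"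
      by (rule eventually_at_left_real[OF pos])
    ultimately have "\<forall>\<^sub>F t in at_left e. 0 < dinkelbach_poly a h b \<gamma> Q0 t \<and> t \<in> {0<..<e}"
      by (rule eventually_conj)
    then obtain t where t: "0 < dinkelbach_poly a h b \<gamma> Q0 t" "0 < t" "t < e"
      using eventually_happens'[OF trivial_limit_at_left_real] by fastforce
    then have "\<forall>x\<in>hyperplane a b. E Q0 \<gamma> h x \<le> t"
      by (simp add: energy_bounded_on_hyperplane_iff[OF a Q0])
    moreover have "hyperplane a b \<noteq> {}"
      using hyperplane_foot_in_hyperplane[OF a] by blast
    ultimately have "e \<le> t"
      unfolding e by (intro cSUP_least) auto
    with \<open>t < e\<close> show False by simp
  qed
qed

text \<open>
  A positive root \<open>t\<close> satisfies \<open>2 * p * t + q = p * t - r / t > 0\<close>, so the square root of the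
  discriminant is taken with the positive sign.
\<close>
lemma positive_root_of_quadratic:
  fixes p q r t :: real
  assumes p: "p > 0" and r: "r \<le> 0" and t: "t > 0" and root: "p * t\<^sup>2 + q * t + r = 0"
  shows "t = (- q + sqrt (q\<^sup>2 - 4 * p * r)) / (2 * p)"
proof -
  have "(2 * p * t + q) * t = p * t\<^sup>2 - r"
    using root by (simp add: algebra_simps power2_eq_square)
  also have "\<dots> > 0"
    using r mult_pos_pos[OF p zero_less_power[OF t, of 2]] by linarith
  finally have "2 * p * t + q > 0"
    using t by (simp add: zero_less_mult_iff)
  moreover have "(2 * p * t + q)\<^sup>2 = q\<^sup>2 - 4 * p * r"
    using root by algebra
  ultimately have "sqrt (q\<^sup>2 - 4 * p * r) = 2 * p * t + q"
    by (metis less_imp_le real_sqrt_abs abs_of_nonneg)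
  then show ?thesis using p by simp
qed

theorem corollary3p2:
  fixes a h :: "'a::euclidean_space"
    and b \<gamma> Q0 :: real
  defines "C \<equiv> hyperplane a b"
  defines "\<beta>1 \<equiv> b\<^sup>2 / (2 * (norm a)\<^sup>2) + Q0"
    and "\<beta>2 \<equiv> b * inner a h / (norm a)\<^sup>2 + \<gamma>"
    and "\<beta>3 \<equiv> 1/2 * ((inner a h)\<^sup>2 / (norm a)\<^sup>2) - 1/2 * (norm h)\<^sup>2"
  defines "e \<equiv> (SUP x\<in>C. E Q0 \<gamma> h x)"
  defines "u \<equiv> proj C (- (inverse e *\<^sub>R h))"
  assumes "a \<noteq> 0"
    and "Q0 > 0"
    and "(SUP x\<in>C. E Q0 \<gamma> h x) > 0"
  shows "(\<forall>y. proj C y = y - ((inner a y - b) / (norm a)\<^sup>2) *\<^sub>R a)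
    \<and> (u \<in> C \<and> (\<forall>x\<in>C. E Q0 \<gamma> h x \<le> E Q0 \<gamma> h u))
    \<and> e = E Q0 \<gamma> h u
    \<and> e = (- \<beta>2 + sqrt (\<beta>2\<^sup>2 - 4 * \<beta>1 * \<beta>3)) / (2 * \<beta>1)"
proof -
  have pos: "e > 0" using assms(9) by (simp add: e_def)
  have proj: "proj C y = hyperplane_foot a b y" for y
    unfolding C_def by (rule proj_hyperplane[OF \<open>a \<noteq> 0\<close>])
  have u_foot: "u = hyperplane_foot a b (- (inverse e *\<^sub>R h))"
    unfolding u_def by (rule proj)
  have u: "u \<in> C"
    unfolding u_foot C_def by (rule hyperplane_foot_in_hyperplane[OF \<open>a \<noteq> 0\<close>])
  have zero: "dinkelbach_poly a h b \<gamma> Q0 e = 0"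
    using \<open>a \<noteq> 0\<close> \<open>Q0 > 0\<close> _ pos by (rule dinkelbach_poly_SUP_energy) (simp add: e_def C_def)
  have "\<gamma> + inner h u + e * Q Q0 u = 0"
    using parametric_energy_on_hyperplane[OF \<open>a \<noteq> 0\<close> pos u[unfolded C_def], of \<gamma> h Q0]
    unfolding u_foot[symmetric] zero by simp
  then have "- (\<gamma> + inner h u) = e * Q Q0 u" by simp
  then have value_u: "e = E Q0 \<gamma> h u"
    using Q_pos[OF \<open>Q0 > 0\<close>, of u]
    by (simp only: E_def minus_divide_left) simp
  have max: "E Q0 \<gamma> h x \<le> e" if "x \<in> C" for x
    unfolding e_def by (rule cSUP_upper[OF that bdd_above_E[OF \<open>Q0 > 0\<close>]])
  have "(inner a h)\<^sup>2 \<le> (norm a)\<^sup>2 * (norm h)\<^sup>2"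
    using Cauchy_Schwarz_ineq[of a h] by (simp add: power2_norm_eq_inner)
  then have "\<beta>3 \<le> 0"
    using \<open>a \<noteq> 0\<close> by (simp add: \<beta>3_def pos_divide_le_eq mult.commute)
  moreover have "\<beta>1 > 0"
    unfolding \<beta>1_def using \<open>Q0 > 0\<close> by (intro add_nonneg_pos) auto
  moreover have "\<beta>1 * e\<^sup>2 + \<beta>2 * e + \<beta>3 = 0"
    using zero by (simp add: dinkelbach_poly_def \<beta>1_def \<beta>2_def \<beta>3_def)
  ultimately have "e = (- \<beta>2 + sqrt (\<beta>2\<^sup>2 - 4 * \<beta>1 * \<beta>3)) / (2 * \<beta>1)"
    using pos by (intro positive_root_of_quadratic)
  then show ?thesis
    using proj u value_u max by (simp add: hyperplane_foot_def)
qed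

end
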